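(* Let $\mu>0$, $\lambda>0$, $\sigma>0$ satisfy $\frac{\mu\lambda}{\sigma^2}> 1$ and let $x_0\in\mathbb{R}$. Then $$\mathcal{T}_{\mu\lambda}^{(\sigma)}(x_0)=\begin{cases}\{0\}, & |x_0|< \bar{\tau}_{\mu\lambda,\sigma},\\ \{0,x_1\}, & |x_0|=\bar{\tau}_{\mu\lambda,\sigma},\\ \{x_1\}, & \text{otherwise,}\end{cases}$$ where $x_1:=\sigma W_0\!\left(-\frac{\mu\lambda}{\sigma^2}e^{-\frac{|x_0|}{\sigma}}\right)+|x_0|$ and $\bar{\tau}_{\mu\lambda,\sigma}:=x^*+\frac{\mu\lambda}{\sigma}e^{-\frac{x^*}{\sigma}}$, with $x^*\in(0,\sqrt{2\mu\lambda})$ the unique solution on $(0,+\infty)$ of the equation $$\frac12+\mu\lambda\,\frac{\left(\frac{x}{\sigma}+1\right)e^{-\frac{x}{\sigma}}-1}{x^2}=0.$$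
   Context: For $\mu,\lambda,\sigma>0$ and $x_0\in\mathbb{R}$, let $\widehat{L}(x,x_0):=\lambda\left(1-e^{-\frac{x}{\sigma}}\right)+\frac{1}{2\mu}(x-|x_0|)^2$ for $x\ge 0$, and let $\mathcal{T}_{\mu\lambda}^{(\sigma)}(x_0):=\arg\min_{x\ge 0}\widehat{L}(x,x_0)$ denote the set of all global minimizers of $\widehat{L}(\cdot,x_0)$ over $[0,+\infty)$. (The proximal operator of the piece-wise exponential function $1-e^{-|x|/\sigma}$ is then $\mathrm{sign}(x_0)\mathcal{T}_{\mu\lambda}^{(\sigma)}(x_0)$.) The equation defining $x^*$ is $H'(x)=0$ for $H(x):=\frac12 x+\mu\lambda\frac{1-e^{-x/\sigma}}{x}$, $x>0$; when $\frac{\mu\lambda}{\sigma^2}>1$ it has exactly one solution on $(0,+\infty)$, lying in $(0,\sqrt{2\mu\lambda})$. $W_0$ is the principal branch of the Lambert W function: for $y\in[-\frac1e,+\infty)$, $W_0(y)$ is the unique $w\ge -1$ with $we^{w}=y$. The quantity $x_1$ is only used in the cases in which it appears, where the argument of $W_0$ lies in $[-\frac1e,0)$. *)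

theory Defs
  imports "HOL-Analysis.Analysis"
begin

definition Lhat :: "real \<Rightarrow> real \<Rightarrow> real \<Rightarrow> real \<Rightarrow> real \<Rightarrow> real" where
  "Lhat \<mu> lam \<sigma> x0 x = lam * (1 - exp (- x / \<sigma>)) + 1 / (2 * \<mu>) * (x - \<bar>x0\<bar>)\<^sup>2"

definition prox_set :: "real \<Rightarrow> real \<Rightarrow> real \<Rightarrow> real \<Rightarrow> real set" where
  "prox_set \<mu> lam \<sigma> x0 = {x. is_arg_min (Lhat \<mu> lam \<sigma> x0) (\<lambda>y. 0 \<le> y) x}"

(* Only meaningful for y >= - 1/e; the value is unspecified elsewhere. *)
definition Lambert_W0 :: "real \<Rightarrow> real" where
  "Lambert_W0 y = (THE w. - 1 \<le> w \<and> w * exp w = y)"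

definition xstar_eq :: "real \<Rightarrow> real \<Rightarrow> real \<Rightarrow> real \<Rightarrow> bool" where
  "xstar_eq \<mu> lam \<sigma> x \<longleftrightarrow>
     1 / 2 + \<mu> * lam * (((x / \<sigma> + 1) * exp (- x / \<sigma>) - 1) / x\<^sup>2) = 0"

definition xstar :: "real \<Rightarrow> real \<Rightarrow> real \<Rightarrow> real" where
  "xstar \<mu> lam \<sigma> = (THE x. 0 < x \<and> xstar_eq \<mu> lam \<sigma> x)"

definition tau_bar :: "real \<Rightarrow> real \<Rightarrow> real \<Rightarrow> real" where
  "tau_bar \<mu> lam \<sigma> =
     xstar \<mu> lam \<sigma> + \<mu> * lam / \<sigma> * exp (- xstar \<mu> lam \<sigma> / \<sigma>)"

definition x1 :: "real \<Rightarrow> real \<Rightarrow> real \<Rightarrow> real \<Rightarrow> real" where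
  "x1 \<mu> lam \<sigma> x0 =
     \<sigma> * Lambert_W0 (- (\<mu> * lam / \<sigma>\<^sup>2) * exp (- \<bar>x0\<bar> / \<sigma>)) + \<bar>x0\<bar>"

end

theory Submission
  imports Defs
begin

text \<open>
  Put \<open>c = \<mu> * lam\<close> and \<open>a = \<bar>x0\<bar>\<close>. Up to the factor \<open>\<mu>\<close> and an additive constant the objective is
  \<open>F x = x\<^sup>2 / 2 - a * x + c * (1 - exp (- x / \<sigma>))\<close>, and \<open>F x = x * (H x - a)\<close> for \<open>x > 0\<close>, where
  \<open>H x = x / 2 + c * (1 - exp (- x / \<sigma>)) / x\<close>. The sign of \<open>H'\<close> is that of \<open>G x = x\<^sup>2 * H' x\<close>, and
  \<open>G' x = x * (1 - c / \<sigma>\<^sup>2 * exp (- x / \<sigma>))\<close> changes sign just once, from negative to positive, at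
  \<open>m = \<sigma> * ln (c / \<sigma>\<^sup>2) > 0\<close>. As \<open>G\<close> vanishes at \<open>0\<close> and is positive at \<open>sqrt (2 * c)\<close>, it has a single
  positive zero, \<open>x\<^sup>*\<close>, which lies beyond \<open>m\<close>; and \<open>H\<close> has its strict minimum there. The
  threshold is this minimum: \<open>H x\<^sup>* = \<tau>\<close>. Therefore \<open>F x \<ge> x * (\<tau> - a)\<close> on the half-line, with
  equality just at \<open>0\<close> and \<open>x\<^sup>*\<close> (lemma \<open>chord_below_objective\<close>).

  For \<open>a < \<tau>\<close> this bound leaves \<open>0\<close> as the only minimizer, and for \<open>a = \<tau>\<close> the minimizers are
  \<open>0\<close> and \<open>x\<^sup>*\<close>. For \<open>a > \<tau>\<close> the bound decreases in \<open>x\<close>, so no point of \<open>[0, x\<^sup>*]\<close> does better than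
  \<open>x\<^sup>*\<close>; to the right of \<open>x\<^sup>*\<close> the function \<open>F\<close> is strictly convex and has a negative slope \<open>\<tau> - a\<close>
  at \<open>x\<^sup>*\<close>, so it is minimal at the only critical point there. Finally a critical point beyond
  \<open>m\<close> is given by the principal branch of the Lambert function, because \<open>x \<ge> m\<close> says that
  \<open>(x - a) / \<sigma> \<ge> - 1\<close> at a critical point (lemma \<open>critical_point_eq_Lambert\<close>).
\<close>

section \<open>The principal branch of the Lambert function\<close>

lemma mult_exp_strict_mono:
  fixes v w :: real
  assumes "- 1 \<le> v" "v < w"
  shows "v * exp v < w * exp w"
proof (rule DERIV_pos_imp_increasing_open[OF assms(2)])
  fix x assume "v < x" "x < w"
  then have "0 < (1 + x) * exp x" using assms by simp
  moreover have "((\<lambda>x. x * exp x) has_real_derivative (1 + x) * exp x) (at x)"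
    by (auto intro!: derivative_eq_intros simp: algebra_simps)
  ultimately show "\<exists>y. ((\<lambda>x. x * exp x) has_real_derivative y) (at x) \<and> 0 < y" by blast
qed (intro continuous_intros)

lemma Lambert_W0_mult_exp:
  assumes "- 1 \<le> w"
  shows "Lambert_W0 (w * exp w) = w"
  unfolding Lambert_W0_def
proof (rule the_equality)
  fix v assume v: "- 1 \<le> v \<and> v * exp v = w * exp w"
  then show "v = w"
    using mult_exp_strict_mono[of v w] mult_exp_strict_mono[of w v] assms
    by (cases v w rule: linorder_cases) auto
qed (use assms in simp)

section \<open>The auxiliary functions\<close>

locale supercritical =
  fixes c \<sigma> :: real
  assumes sigma_pos: "0 < \<sigma>" and ratio: "1 < c / \<sigma>\<^sup>2"
begin

lemma c_pos: "0 < c"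
  using sigma_pos ratio by (smt (verit) divide_nonpos_pos zero_less_power)

definition m :: real where
  "m = \<sigma> * ln (c / \<sigma>\<^sup>2)"

definition G :: "real \<Rightarrow> real" where
  "G x = x\<^sup>2 / 2 + c * ((x / \<sigma> + 1) * exp (- x / \<sigma>) - 1)"

definition H :: "real \<Rightarrow> real" where
  "H x = x / 2 + c * (1 - exp (- x / \<sigma>)) / x"

definition F :: "real \<Rightarrow> real \<Rightarrow> real" where
  "F a x = x\<^sup>2 / 2 - a * x + c * (1 - exp (- x / \<sigma>))"

definition F' :: "real \<Rightarrow> real \<Rightarrow> real" where
  "F' a x = x - a + c / \<sigma> * exp (- x / \<sigma>)"

lemma m_pos: "0 < m"
  unfolding m_def using sigma_pos ratio by (intro mult_pos_pos ln_gt_zero)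

lemma ratio_mult_exp: "c / \<sigma>\<^sup>2 * exp (- x / \<sigma>) = exp ((m - x) / \<sigma>)"
proof -
  have "(m - x) / \<sigma> = ln (c / \<sigma>\<^sup>2) + - x / \<sigma>"
    using sigma_pos by (simp add: m_def diff_divide_distrib)
  moreover have "0 < c / \<sigma>\<^sup>2" using ratio by linarith
  ultimately show ?thesis by (simp only: exp_add exp_ln)
qed

lemma exp_less_one_iff: "c / \<sigma>\<^sup>2 * exp (- x / \<sigma>) < 1 \<longleftrightarrow> m < x"
  unfolding ratio_mult_exp using sigma_pos by (simp add: divide_less_0_iff)

lemma one_less_exp_iff: "1 < c / \<sigma>\<^sup>2 * exp (- x / \<sigma>) \<longleftrightarrow> x < m"
  unfolding ratio_mult_exp using sigma_pos by (simp add: zero_less_divide_iff)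

lemma G_deriv: "(G has_real_derivative x * (1 - c / \<sigma>\<^sup>2 * exp (- x / \<sigma>))) (at x)"
  unfolding G_def using sigma_pos
  by (auto intro!: derivative_eq_intros simp: field_simps power2_eq_square)

lemma H_deriv:
  assumes "0 < x"
  shows "(H has_real_derivative G x / x\<^sup>2) (at x)"
  unfolding H_def G_def using sigma_pos assms
  by (auto intro!: derivative_eq_intros simp: field_simps power2_eq_square)

lemma F_deriv: "(F a has_real_derivative F' a x) (at x)"
  unfolding F_def F'_def using sigma_pos
  by (auto intro!: derivative_eq_intros simp: field_simps power2_eq_square)

lemma F'_deriv: "(F' a has_real_derivative 1 - c / \<sigma>\<^sup>2 * exp (- x / \<sigma>)) (at x)"
  unfolding F'_def using sigma_pos
  by (auto intro!: derivative_eq_intros simp: field_simps power2_eq_square)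

lemmas G_cont = DERIV_continuous_on[OF DERIV_subset[OF G_deriv subset_UNIV]]
lemmas F_cont = DERIV_continuous_on[OF DERIV_subset[OF F_deriv subset_UNIV]]
lemmas F'_cont = DERIV_continuous_on[OF DERIV_subset[OF F'_deriv subset_UNIV]]

lemma F_eq: "x \<noteq> 0 \<Longrightarrow> F a x = x * (H x - a)"
  by (simp add: F_def H_def field_simps power2_eq_square)

lemma F_zero: "F a 0 = 0"
  by (simp add: F_def)

section \<open>The minimum of H\<close>

lemma G_neg:
  assumes "0 < x" "x \<le> m"
  shows "G x < 0"
proof -
  have "G x < G 0"
  proof (rule DERIV_neg_imp_decreasing_open[OF assms(1) _ G_cont])
    fix y assume "0 < y" "y < x"
    then have "y * (1 - c / \<sigma>\<^sup>2 * exp (- y / \<sigma>)) < 0"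
      using one_less_exp_iff[of y] assms by (simp add: mult_pos_neg)
    then show "\<exists>d. (G has_real_derivative d) (at y) \<and> d < 0" using G_deriv by blast
  qed
  then show ?thesis by (simp add: G_def)
qed

lemma G_strict_mono:
  assumes "m \<le> x" "x < y"
  shows "G x < G y"
proof (rule DERIV_pos_imp_increasing_open[OF assms(2) _ G_cont])
  fix z assume z: "x < z" "z < y"
  then have "0 < z * (1 - c / \<sigma>\<^sup>2 * exp (- z / \<sigma>))"
    using exp_less_one_iff[of z] assms m_pos by simp
  then show "\<exists>d. (G has_real_derivative d) (at z) \<and> 0 < d" using G_deriv by blast
qed

lemma G_sqrt_pos: "0 < G (sqrt (2 * c))"
proof -
  have "G (sqrt (2 * c)) = c * ((sqrt (2 * c) / \<sigma> + 1) * exp (- sqrt (2 * c) / \<sigma>))"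
    using c_pos by (simp add: G_def algebra_simps)
  also have "0 < \<dots>" using c_pos sigma_pos by (intro mult_pos_pos add_nonneg_pos) auto
  finally show ?thesis .
qed

lemma ex_zero_of_G: "\<exists>x. m < x \<and> x < sqrt (2 * c) \<and> G x = 0"
proof -
  have m: "G m < 0" using G_neg m_pos by simp
  have less: "m < sqrt (2 * c)"
    using G_neg[of "sqrt (2 * c)"] G_sqrt_pos c_pos by (smt (verit) real_sqrt_gt_zero)
  obtain x where "m \<le> x" "x \<le> sqrt (2 * c)" "G x = 0"
    using IVT'[of G m 0 "sqrt (2 * c)"] m G_sqrt_pos less G_cont by force
  then show ?thesis using m G_sqrt_pos by (metis less_eq_real_def less_irrefl)
qed

definition xs :: real where
  "xs = (SOME x. m < x \<and> x < sqrt (2 * c) \<and> G x = 0)"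

lemma xs: "m < xs" "xs < sqrt (2 * c)" "G xs = 0"
  using someI_ex[OF ex_zero_of_G] by (simp_all add: xs_def)

lemma xs_pos: "0 < xs"
  using xs(1) m_pos by linarith

lemma G_neg_iff:
  assumes "0 < x"
  shows "G x < 0 \<longleftrightarrow> x < xs"
  using G_neg[OF assms] G_strict_mono[of x xs] G_strict_mono[of xs x] xs
  by (smt (verit))

lemma G_zero_iff:
  assumes "0 < x"
  shows "G x = 0 \<longleftrightarrow> x = xs"
  using G_neg_iff[OF assms] G_strict_mono[of xs x] xs by (smt (verit))

lemma H_greater:
  assumes "0 < x" "x \<noteq> xs"
  shows "H xs < H x"
proof -
  have cont: "continuous_on {u..v} H" if "0 < u" for u v
    by (rule DERIV_continuous_on[OF DERIV_subset[OF H_deriv subset_UNIV]]) (use that in simp)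
  consider "x < xs" | "xs < x" using assms by linarith
  then show ?thesis
  proof cases
    case 1
    show ?thesis
    proof (rule DERIV_neg_imp_decreasing_open[OF 1 _ cont[OF assms(1)]])
      fix z assume z: "x < z" "z < xs"
      then have "0 < z" "G z / z\<^sup>2 < 0"
        using G_neg_iff[of z] assms by (simp_all add: divide_neg_pos)
      then show "\<exists>d. (H has_real_derivative d) (at z) \<and> d < 0" using H_deriv by blast
    qed
  next
    case 2
    show ?thesis
    proof (rule DERIV_pos_imp_increasing_open[OF 2 _ cont[OF xs_pos]])
      fix z assume z: "xs < z" "z < x"
      then have "0 < z" "G z / z\<^sup>2 > 0"
        using G_strict_mono[of xs z] xs xs_pos by simp_all
      then show "\<exists>d. (H has_real_derivative d) (at z) \<and> 0 < d" using H_deriv by blast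
    qed
  qed
qed

definition tau :: real where
  "tau = xs + c / \<sigma> * exp (- xs / \<sigma>)"

lemma H_xs: "H xs = tau"
proof -
  \<comment> \<open>\<open>G xs = 0\<close> solved for the numerator of the quotient in \<open>H\<close>\<close>
  have "c * (1 - exp (- xs / \<sigma>)) = xs\<^sup>2 / 2 + xs * (c / \<sigma> * exp (- xs / \<sigma>))"
    using xs(3) by (simp add: G_def algebra_simps)
  then show ?thesis
    using xs_pos by (simp add: H_def tau_def add_divide_distrib power2_eq_square)
qed

text \<open>The line through the origin with slope \<open>tau - a\<close> meets the graph of \<open>F a\<close> at \<open>0\<close> and touches it at
  \<open>xs\<close>. This is the minimality of \<open>H xs\<close> multiplied by \<open>x\<close>.\<close>

lemma chord_below_objective:
  assumes "0 \<le> x"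
  shows "x * (tau - a) \<le> F a x"
    and "x * (tau - a) = F a x \<longleftrightarrow> x = 0 \<or> x = xs"
proof -
  have less: "x * (tau - a) < F a x" if "x \<noteq> 0" "x \<noteq> xs"
    using H_greater[of x] H_xs that assms by (simp add: F_eq)
  have eq: "x * (tau - a) = F a x" if "x = 0 \<or> x = xs"
    using that H_xs xs_pos by (auto simp: F_zero F_eq)
  show "x * (tau - a) \<le> F a x" using less eq by fastforce
  show "x * (tau - a) = F a x \<longleftrightarrow> x = 0 \<or> x = xs" using less eq by fastforce
qed

section \<open>Critical points of the objective\<close>

lemma F'_xs: "F' a xs = tau - a"
  by (simp add: F'_def tau_def)

lemma F'_strict_mono:
  assumes "m \<le> x" "x < y"
  shows "F' a x < F' a y"
proof (rule DERIV_pos_imp_increasing_open[OF assms(2) _ F'_cont])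
  fix z assume "x < z" "z < y"
  then have "0 < 1 - c / \<sigma>\<^sup>2 * exp (- z / \<sigma>)" using exp_less_one_iff[of z] assms by simp
  then show "\<exists>d. (F' a has_real_derivative d) (at z) \<and> 0 < d" using F'_deriv by blast
qed

lemma F_greater_than_critical:
  assumes "m \<le> r" "F' a r = 0" "m \<le> x" "x \<noteq> r"
  shows "F a r < F a x"
proof -
  consider "x < r" | "r < x" using assms by linarith
  then show ?thesis
  proof cases
    case 1
    show ?thesis
    proof (rule DERIV_neg_imp_decreasing_open[OF 1 _ F_cont])
      fix z assume "x < z" "z < r"
      then have "F' a z < 0" using F'_strict_mono[of z r a] assms by simp
      then show "\<exists>d. (F a has_real_derivative d) (at z) \<and> d < 0" using F_deriv by blast
    qed
  next
    case 2
    show ?thesis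
    proof (rule DERIV_pos_imp_increasing_open[OF 2 _ F_cont])
      fix z assume "r < z" "z < x"
      then have "0 < F' a z" using F'_strict_mono[of r z a] assms by simp
      then show "\<exists>d. (F a has_real_derivative d) (at z) \<and> 0 < d" using F_deriv by blast
    qed
  qed
qed

lemma ex_critical_point:
  assumes "tau < a"
  shows "\<exists>r > xs. F' a r = 0"
proof -
  have "xs \<le> tau" using c_pos sigma_pos by (simp add: tau_def)
  then have "xs \<le> a" using assms by simp
  moreover have "F' a xs < 0" using assms F'_xs by simp
  moreover have "0 \<le> F' a a" using c_pos sigma_pos by (simp add: F'_def)
  ultimately obtain r where "xs \<le> r" "F' a r = 0"
    using IVT'[of "F' a" xs 0 a] F'_cont by force
  then show ?thesis using \<open>F' a xs < 0\<close> by (metis less_eq_real_def less_irrefl)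
qed

text \<open>With \<open>w = (r - a) / \<sigma>\<close> the equation \<open>F' a r = 0\<close> reads
  \<open>w = - (c / \<sigma>\<^sup>2) * exp (- r / \<sigma>)\<close>, and multiplication by \<open>exp w\<close> removes \<open>r\<close> from the right-hand
  side. Being to the right of \<open>m\<close> selects the principal branch \<open>w \<ge> - 1\<close>.\<close>

lemma critical_point_eq_Lambert:
  assumes "m < r" "F' a r = 0"
  shows "\<sigma> * Lambert_W0 (- (c / \<sigma>\<^sup>2) * exp (- a / \<sigma>)) + a = r"
proof -
  define w where "w = (r - a) / \<sigma>"
  have "r - a = - (c / \<sigma> * exp (- r / \<sigma>))"
    using assms(2) by (simp add: F'_def)
  then have w: "w = - (c / \<sigma>\<^sup>2) * exp (- r / \<sigma>)"
    using sigma_pos by (simp add: w_def power2_eq_square)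
  have "- r / \<sigma> + w = - a / \<sigma>"
    by (simp add: w_def diff_divide_distrib)
  then have "w * exp w = - (c / \<sigma>\<^sup>2) * exp (- a / \<sigma>)"
    by (subst w) (simp only: mult.assoc exp_add[symmetric])
  moreover have "- 1 \<le> w"
    using exp_less_one_iff[of r] assms(1) w by simp
  ultimately show ?thesis
    using Lambert_W0_mult_exp[of w] sigma_pos by (simp add: w_def)
qed

section \<open>The minimizers of the objective\<close>

lemma minimizers_of_F:
  "{x. is_arg_min (F a) (\<lambda>y. 0 \<le> y) x} =
     (if a < tau then {0}
      else if a = tau then {0, \<sigma> * Lambert_W0 (- (c / \<sigma>\<^sup>2) * exp (- a / \<sigma>)) + a}
      else {\<sigma> * Lambert_W0 (- (c / \<sigma>\<^sup>2) * exp (- a / \<sigma>)) + a})"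
    (is "?M = (if _ then _ else if _ then {0, ?x1} else {?x1})")
proof -
  have min_iff: "x \<in> ?M \<longleftrightarrow> 0 \<le> x \<and> (\<forall>y\<ge>0. F a x \<le> F a y)" for x
    by (auto simp: is_arg_min_linorder)
  consider "a < tau" | "a = tau" | "tau < a" by linarith
  then show ?thesis
  proof cases
    case 1
    have pos: "0 < F a x" if "0 < x" for x
      using chord_below_objective(1)[of x a] mult_pos_pos[of x "tau - a"] 1 that by linarith
    have "x \<in> ?M \<longleftrightarrow> x = 0" for x
      unfolding min_iff using pos F_zero by (metis less_eq_real_def not_less)
    then show ?thesis using 1 by auto
  next
    case 2
    have nonneg: "0 \<le> F a x" and zero: "F a x = 0 \<longleftrightarrow> x = 0 \<or> x = xs" if "0 \<le> x" for x
      using chord_below_objective[of x a] 2 that by auto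
    have "x \<in> ?M \<longleftrightarrow> x = 0 \<or> x = xs" for x
      unfolding min_iff using nonneg zero F_zero xs_pos by (metis less_eq_real_def order.antisym)
    moreover have "?x1 = xs"
      using critical_point_eq_Lambert[of xs a] F'_xs[of a] xs 2 by simp
    ultimately show ?thesis using 2 by auto
  next
    case 3
    obtain r where r: "xs < r" "F' a r = 0" using ex_critical_point[OF 3] by blast
    have right: "F a r < F a x" if "xs \<le> x" "x \<noteq> r" for x
      using F_greater_than_critical[of r a x] r xs that by simp
    have left: "F a r < F a x" if "0 \<le> x" "x \<le> xs" for x
    proof -
      have "F a r < F a xs" using right r by simp
      also have "F a xs = xs * (tau - a)" using chord_below_objective(2)[of xs a] xs_pos by simp
      also have "\<dots> \<le> x * (tau - a)" using that 3 by (simp add: mult_right_mono_neg)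
      also have "\<dots> \<le> F a x" using chord_below_objective(1) that by simp
      finally show ?thesis .
    qed
    have less: "F a r < F a x" if "0 \<le> x" "x \<noteq> r" for x
      using left right that by (meson linear)
    have "x \<in> ?M \<longleftrightarrow> x = r" for x
      unfolding min_iff using less r xs_pos by (metis less_eq_real_def not_less order.trans)
    moreover have "?x1 = r" using critical_point_eq_Lambert r xs by simp
    ultimately show ?thesis using 3 by auto
  qed
qed

end

section \<open>The proximal operator\<close>

theorem mainTheorem2:
  fixes \<mu> lam \<sigma> x0 :: real
  assumes "\<mu> > 0" and "lam > 0" and "\<sigma> > 0"
    and "\<mu> * lam / \<sigma>\<^sup>2 > 1"
  shows "(\<exists>!x. 0 < x \<and> xstar_eq \<mu> lam \<sigma> x)
    \<and> xstar \<mu> lam \<sigma> \<in> {0<..<sqrt (2 * \<mu> * lam)}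
    \<and> prox_set \<mu> lam \<sigma> x0 =
        (if \<bar>x0\<bar> < tau_bar \<mu> lam \<sigma> then {0}
         else if \<bar>x0\<bar> = tau_bar \<mu> lam \<sigma> then {0, x1 \<mu> lam \<sigma> x0}
         else {x1 \<mu> lam \<sigma> x0})"
proof -
  interpret supercritical "\<mu> * lam" \<sigma>
    by unfold_locales (use assms in auto)
  have "xstar_eq \<mu> lam \<sigma> x \<longleftrightarrow> G x = 0" if "0 < x" for x
    using that assms by (simp add: xstar_eq_def G_def field_simps)
  then have eq_iff: "0 < x \<and> xstar_eq \<mu> lam \<sigma> x \<longleftrightarrow> x = xs" for x
    using G_zero_iff xs_pos by blast
  then have xstar: "xstar \<mu> lam \<sigma> = xs"
    by (simp add: xstar_def)
  then have tau: "tau_bar \<mu> lam \<sigma> = tau"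
    by (simp add: tau_bar_def tau_def)
  have "Lhat \<mu> lam \<sigma> x0 x = F \<bar>x0\<bar> x / \<mu> + x0\<^sup>2 / (2 * \<mu>)" for x
    using assms by (simp add: Lhat_def F_def field_simps power2_eq_square)
  then have "Lhat \<mu> lam \<sigma> x0 x \<le> Lhat \<mu> lam \<sigma> x0 y \<longleftrightarrow> F \<bar>x0\<bar> x \<le> F \<bar>x0\<bar> y" for x y
    using assms by (simp add: divide_le_cancel)
  then have "prox_set \<mu> lam \<sigma> x0 = {x. is_arg_min (F \<bar>x0\<bar>) (\<lambda>y. 0 \<le> y) x}"
    by (simp add: prox_set_def is_arg_min_linorder)
  then show ?thesis
    using eq_iff xs_pos xs(2) xstar tau minimizers_of_F[of "\<bar>x0\<bar>"]
    by (simp add: x1_def mult.assoc)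
qed

end
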